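(* Let $(X,T)$ be a dynamical system. Then the following statements are equivalent: (1) $(X,T)$ is uniformly rigid; (2) $(K(X),T_K)$ is uniformly rigid; (3) $(\mathbb{F}_0(X),T_F)$ is uniformly rigid; (4) for every $\lambda\in(0,1]$, $(\mathbb{F}^{=\lambda}(X),T_F|_{\mathbb{F}^{=\lambda}(X)})$ is uniformly rigid; (5) for every $\lambda\in(0,1]$, $(\mathbb{F}^{\ge\lambda}(X),T_F|_{\mathbb{F}^{\ge\lambda}(X)})$ is uniformly rigid; (6) there exists $\lambda\in(0,1]$ such that $(\mathbb{F}^{=\lambda}(X),T_F|_{\mathbb{F}^{=\lambda}(X)})$ is uniformly rigid; (7) there exists $\lambda\in(0,1]$ such that $(\mathbb{F}^{\ge\lambda}(X),T_F|_{\mathbb{F}^{\ge\lambda}(X)})$ is uniformly rigid.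
   Context: A dynamical system $(X,T)$ consists of a nontrivial (more than one point) compact metric space $X$ with metric $d$ and a continuous surjection $T:X\to X$. $I=[0,1]$. Hyperspace: $K(X)$ is the set of all nonempty closed subsets of $X$ with the Hausdorff metric $d_H(A,B)=\max\{\max_{x\in A}\min_{y\in B}d(x,y),\max_{y\in B}\min_{x\in A}d(x,y)\}$, and $T_K:K(X)\to K(X)$ is $T_K(A)=T(A)$. Extend $d_H$ to the empty set by $d_H(\emptyset,\emptyset)=0$ and $d_H(\emptyset,A)=d_H(A,\emptyset)=\mathrm{diam}(X)$ for $A\in K(X)$. Fuzzy sets: $\mathbb{F}(X)$ is the set of all upper semicontinuous functions $A:X\to I$, and $\mathbb{F}_0(X)$ is the set of those $A\in\mathbb{F}(X)$ that are nonempty, i.e. not identically $0$. For $\alpha\in I$, $[A]_\alpha=\{x\in X:A(x)\ge\alpha\}$. The levelwise metric on $\mathbb{F}(X)$ (and on its subsets) is $d_\infty(A,B)=\sup\{d_H([A]_\alpha,[B]_\alpha):\alpha\in(0,1]\}$. For $\lambda\in(0,1]$, $\mathbb{F}^{=\lambda}(X)=\{A\in\mathbb{F}(X):\max_{x\in X}A(x)=\lambda\}$ and $\mathbb{F}^{\ge\lambda}(X)=\{A\in\mathbb{F}(X):A(x)\ge\lambda\text{ for some }x\in X\}$. Zadeh's extension $T_F:\mathbb{F}(X)\to\mathbb{F}(X)$ is $T_F(A)(x)=\sup\{A(y):y\in T^{-1}(x)\}$; it maps each of the sets $\mathbb{F}_0(X)$, $\mathbb{F}^{=\lambda}(X)$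 and $\mathbb{F}^{\ge\lambda}(X)$ (for every $\lambda\in(0,1]$) to itself. For a self-map $S$ of a metric space $Y$, $(Y,S)$ is uniformly rigid if there is a sequence of positive integers $m_i\to+\infty$ such that $S^{m_i}\to\mathrm{id}_Y$ uniformly on $Y$. *)

theory Defs
  imports "HOL-Analysis.Analysis"
begin

locale dynamical_system = Metric_space M d
  for M :: "'a set" and d :: "'a \<Rightarrow> 'a \<Rightarrow> real" +
  fixes T :: "'a \<Rightarrow> 'a"
  assumes compact: "compact_space mtopology"
    and nontrivial: "\<exists>x\<in>M. \<exists>y\<in>M. x \<noteq> y"
    and continuous: "continuous_map mtopology mtopology T"
    and surjective: "T ` M = M"

(* Intended for a map S that sends Y to itself; only the values of S and d on Y then matter,
   so a restriction of S to an invariant set needs no separate notation. *)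
definition uniformly_rigid :: "'b set \<Rightarrow> ('b \<Rightarrow> 'b \<Rightarrow> real) \<Rightarrow> ('b \<Rightarrow> 'b) \<Rightarrow> bool" where
  "uniformly_rigid Y \<rho> S \<longleftrightarrow>
     (\<exists>m :: nat \<Rightarrow> nat. (\<forall>i. 0 < m i) \<and> filterlim m at_top sequentially \<and>
        (\<forall>e>0. \<forall>\<^sub>F i in sequentially. \<forall>y\<in>Y. \<rho> ((S ^^ m i) y) y < e))"

definition hyperspace :: "'a set \<Rightarrow> ('a \<Rightarrow> 'a \<Rightarrow> real) \<Rightarrow> 'a set set" where
  "hyperspace M d = {A. closedin (Metric_space.mtopology M d) A \<and> A \<noteq> {}}"

definition hyper_map :: "('a \<Rightarrow> 'a) \<Rightarrow> 'a set \<Rightarrow> 'a set" where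
  "hyper_map T A = T ` A"

definition diam :: "'a set \<Rightarrow> ('a \<Rightarrow> 'a \<Rightarrow> real) \<Rightarrow> real" where
  "diam M d = (SUP (x, y) \<in> M \<times> M. d x y)"

(* Applied to closed subsets of a compact space, so the suprema and infima are attained
   whenever A and B are nonempty. *)
definition hausdorff_dist :: "'a set \<Rightarrow> ('a \<Rightarrow> 'a \<Rightarrow> real) \<Rightarrow> 'a set \<Rightarrow> 'a set \<Rightarrow> real" where
  "hausdorff_dist M d A B =
     (if A = {} \<and> B = {} then 0
      else if A = {} \<or> B = {} then diam M d
      else max (SUP x\<in>A. INF y\<in>B. d x y) (SUP y\<in>B. INF x\<in>A. d x y))"

(* A function on M is represented by its extensional representative (value undefined off M),
   so that equality of fuzzy sets is equality of functions on M. *)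
definition fuzzy_sets :: "'a set \<Rightarrow> ('a \<Rightarrow> 'a \<Rightarrow> real) \<Rightarrow> ('a \<Rightarrow> real) set" where
  "fuzzy_sets M d =
     {A \<in> M \<rightarrow>\<^sub>E {0..1}. \<forall>r. openin (Metric_space.mtopology M d) {x \<in> M. A x < r}}"

definition fuzzy_sets_nonempty :: "'a set \<Rightarrow> ('a \<Rightarrow> 'a \<Rightarrow> real) \<Rightarrow> ('a \<Rightarrow> real) set" where
  "fuzzy_sets_nonempty M d = {A \<in> fuzzy_sets M d. \<exists>x\<in>M. A x \<noteq> 0}"

definition fuzzy_sets_eq :: "'a set \<Rightarrow> ('a \<Rightarrow> 'a \<Rightarrow> real) \<Rightarrow> real \<Rightarrow> ('a \<Rightarrow> real) set" where
  "fuzzy_sets_eq M d l =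
     {A \<in> fuzzy_sets M d. (\<exists>x\<in>M. A x = l) \<and> (\<forall>x\<in>M. A x \<le> l)}"

definition fuzzy_sets_ge :: "'a set \<Rightarrow> ('a \<Rightarrow> 'a \<Rightarrow> real) \<Rightarrow> real \<Rightarrow> ('a \<Rightarrow> real) set" where
  "fuzzy_sets_ge M d l = {A \<in> fuzzy_sets M d. \<exists>x\<in>M. l \<le> A x}"

definition level_set :: "'a set \<Rightarrow> ('a \<Rightarrow> real) \<Rightarrow> real \<Rightarrow> 'a set" where
  "level_set M A \<alpha> = {x \<in> M. \<alpha> \<le> A x}"

definition levelwise_dist ::
  "'a set \<Rightarrow> ('a \<Rightarrow> 'a \<Rightarrow> real) \<Rightarrow> ('a \<Rightarrow> real) \<Rightarrow> ('a \<Rightarrow> real) \<Rightarrow> real" where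
  "levelwise_dist M d A B =
     (SUP \<alpha>\<in>{0<..1}. hausdorff_dist M d (level_set M A \<alpha>) (level_set M B \<alpha>))"

(* For T surjective on M the supremum is over a nonempty subset of the unit interval. *)
definition zadeh :: "'a set \<Rightarrow> ('a \<Rightarrow> 'a) \<Rightarrow> ('a \<Rightarrow> real) \<Rightarrow> ('a \<Rightarrow> real)" where
  "zadeh M T A = (\<lambda>x\<in>M. SUP y\<in>{y \<in> M. T y = x}. A y)"

end

theory Submission
  imports Defs
begin

text \<open>Compactness makes the supremum in Zadeh's extension attained, so \<open>zadeh M T\<close> acts on every
  level set as \<open>T\<close> acts on subsets of \<open>M\<close>. Moving no point by more than \<open>e\<close> moves no set by more
  than \<open>e\<close> in the Hausdorff distance, hence no fuzzy set by more than \<open>e\<close> levelwise; conversely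
  points embed isometrically as singletons, and as fuzzy points of any fixed height.\<close>

context dynamical_system
begin

section \<open>Iterates of \<open>T\<close> and bounds on the Hausdorff distance\<close>

lemma map_closed: "x \<in> M \<Longrightarrow> T x \<in> M"
  using surjective by blast

lemma hyper_map_funpow: "(hyper_map T ^^ n) A = (T ^^ n) ` A"
  by (induction n) (auto simp: hyper_map_def image_image)

text \<open>Compactness bounds the distances on \<open>M\<close>, without which the real-valued
  \<open>SUP\<close> in \<open>diam\<close> would say nothing.\<close>

lemma dist_le_diam:
  assumes "x \<in> M" "y \<in> M"
  shows "d x y \<le> diam M d"
proof -
  have "mbounded M"
    using compact compactin_imp_mbounded compact_space_def by fastforce
  then obtain B where "\<forall>x\<in>M. \<forall>y\<in>M. d x y \<le> B"
    unfolding mbounded_alt by blast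
  then have "bdd_above ((\<lambda>(x, y). d x y) ` (M \<times> M))"
    by (intro bdd_aboveI[where M = B]) auto
  then show ?thesis
    unfolding diam_def using assms by (intro cSUP_upper2[where x = "(x, y)"]) auto
qed

text \<open>Distances are bounded below by 0, so each infimum is at most the distance to a single
  witness.\<close>

lemma SUP_INF_dist_le:
  assumes "A \<noteq> {}" and "\<And>x. x \<in> A \<Longrightarrow> \<exists>y\<in>B. d x y \<le> e"
  shows "(SUP x\<in>A. INF y\<in>B. d x y) \<le> e"
proof (rule cSUP_least[OF assms(1)])
  fix x assume "x \<in> A"
  then obtain y where "y \<in> B" "d x y \<le> e" using assms(2) by blast
  then show "(INF y\<in>B. d x y) \<le> e"
    by (intro cINF_lower2[where x = y]) (auto intro: bdd_belowI[where m = 0])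
qed

lemma hausdorff_dist_le:
  assumes "A \<noteq> {}" "B \<noteq> {}"
    and "\<And>x. x \<in> A \<Longrightarrow> \<exists>y\<in>B. d x y \<le> e"
    and "\<And>y. y \<in> B \<Longrightarrow> \<exists>x\<in>A. d y x \<le> e"
  shows "hausdorff_dist M d A B \<le> e"
  using SUP_INF_dist_le[of A B e] SUP_INF_dist_le[of B A e] assms
  unfolding hausdorff_dist_def by (simp add: commute)

text \<open>The bound does not depend on the two sets, so it also bounds the supremum over levels in
  \<open>levelwise_dist\<close>.\<close>

lemma hausdorff_dist_le_diam:
  assumes "A \<subseteq> M" "B \<subseteq> M"
  shows "hausdorff_dist M d A B \<le> diam M d"
proof -
  obtain x where "x \<in> M" using nontrivial by blast
  \<comment> \<open>Two empty sets have distance 0, so that case needs a nonnegative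
    diameter.\<close>
  then have "0 \<le> diam M d" using dist_le_diam[of x x] by simp
  then show ?thesis
  proof (cases "A = {} \<or> B = {}")
    case False
    then show ?thesis
      using assms by (intro hausdorff_dist_le) (blast intro: dist_le_diam)+
  qed (auto simp: hausdorff_dist_def)
qed

lemma hausdorff_dist_singletons: "hausdorff_dist M d {x} {y} = d x y"
  by (simp add: hausdorff_dist_def)

text \<open>The points \<open>x\<close> and \<open>f x\<close> serve as partners for each other in
  both directions. The empty set is included because level sets above the height of a fuzzy set are
  empty; both sides are then empty, at distance 0.\<close>

lemma hausdorff_dist_image_le:
  assumes "0 \<le> e" "A \<subseteq> M" and "\<And>x. x \<in> M \<Longrightarrow> d (f x) x \<le> e"
  shows "hausdorff_dist M d (f ` A) A \<le> e"
proof (cases "A = {}")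
  case False
  have "d (f x) x \<le> e \<and> d x (f x) \<le> e" if "x \<in> A" for x
    using assms(2,3) that commute by (metis subsetD)
  with False show ?thesis
    by (intro hausdorff_dist_le) blast+
qed (simp add: hausdorff_dist_def assms)

section \<open>Level sets and Zadeh's extension\<close>

lemma closedin_level_set:
  assumes "A \<in> fuzzy_sets M d"
  shows "closedin mtopology (level_set M A \<alpha>)"
proof -
  have "M - level_set M A \<alpha> = {x \<in> M. A x < \<alpha>}"
    by (auto simp: level_set_def)
  then show ?thesis
    using assms by (auto simp: closedin_def level_set_def fuzzy_sets_def)
qed

lemma closedin_fiber:
  assumes "x \<in> M"
  shows "closedin mtopology {y \<in> M. T y = x}"
proof -
  have "closedin mtopology {y \<in> topspace mtopology. T y \<in> {x}}"
    using assms by (intro closedin_continuous_map_preimage[OF continuous])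
      (simp add: closedin_Hausdorff_singleton Hausdorff_space_mtopology)
  then show ?thesis by simp
qed

text \<open>Extreme value theorem for upper semicontinuous functions. If no maximum existed, the
  open sets where \<open>A\<close> lies below one of its values on \<open>C\<close> would cover the
  compact set \<open>C\<close>.\<close>

lemma fuzzy_set_attains_sup:
  assumes A: "A \<in> fuzzy_sets M d" and C: "closedin mtopology C" "C \<noteq> {}"
  shows "\<exists>y\<in>C. \<forall>z\<in>C. A z \<le> A y"
proof (rule ccontr)
  assume "\<not> ?thesis"
  then have *: "\<forall>y\<in>C. \<exists>z\<in>C. A y < A z" by (simp add: not_le)
  let ?U = "\<lambda>z. {x \<in> M. A x < A z}"
  have CM: "C \<subseteq> M" using closedin_subset[OF C(1)] by simp
  have "compactin mtopology C"
    using C(1) closedin_compact_space compact by blast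
  moreover have "\<And>U. U \<in> ?U ` C \<Longrightarrow> openin mtopology U"
    using A by (auto simp: fuzzy_sets_def)
  moreover have "C \<subseteq> \<Union>(?U ` C)" using * CM by blast
  ultimately obtain F where "finite F" "F \<subseteq> ?U ` C" "C \<subseteq> \<Union>F"
    using compactinD[of mtopology C "?U ` C"] by blast
  then obtain D where D: "finite D" "D \<subseteq> C" "C \<subseteq> \<Union>(?U ` D)"
    using finite_subset_image[of F ?U C] by blast
  with C have "D \<noteq> {}" by blast
  with D(1) have "Max (A ` D) \<in> A ` D" by simp
  then obtain z where z: "z \<in> D" "Max (A ` D) = A z" by blast
  \<comment> \<open>The point \<open>z\<close> maximizes \<open>A\<close> over the finite index set
    \<open>D\<close>, so no set of the subcover can contain it.\<close>
  have "\<exists>w\<in>D. A z < A w" using D(2,3) z(1) by blast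
  moreover have "A w \<le> A z" if "w \<in> D" for w
    using Max_ge[of "A ` D" "A w"] D(1) that z(2) by simp
  ultimately show False by (meson not_le)
qed

lemma zadeh_attained:
  assumes "A \<in> fuzzy_sets M d" "x \<in> M"
  obtains y where "y \<in> M" "T y = x" "zadeh M T A x = A y"
    "\<And>z. z \<in> M \<Longrightarrow> T z = x \<Longrightarrow> A z \<le> A y"
proof -
  let ?C = "{y \<in> M. T y = x}"
  from assms(2) have "x \<in> T ` M" by (simp add: surjective)
  then have "?C \<noteq> {}" by blast
  then obtain y where y: "y \<in> ?C" "\<forall>z\<in>?C. A z \<le> A y"
    using fuzzy_set_attains_sup[OF assms(1) closedin_fiber[OF assms(2)]] by blast
  then have "(SUP y\<in>?C. A y) = A y"
    by (intro cSup_eq_maximum) blast+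
  then show thesis using that[of y] y assms(2) by (simp add: zadeh_def)
qed

text \<open>The first inclusion needs the attained supremum: some preimage of \<open>x\<close>
  itself reaches the level \<alpha>. The second uses only that the supremum dominates every value on
  the fiber.\<close>

lemma level_set_zadeh:
  assumes "A \<in> fuzzy_sets M d"
  shows "level_set M (zadeh M T A) \<alpha> = T ` level_set M A \<alpha>"
proof
  show "level_set M (zadeh M T A) \<alpha> \<subseteq> T ` level_set M A \<alpha>"
  proof
    fix x assume "x \<in> level_set M (zadeh M T A) \<alpha>"
    then have x: "x \<in> M" "\<alpha> \<le> zadeh M T A x" by (auto simp: level_set_def)
    obtain y where "y \<in> M" "T y = x" "zadeh M T A x = A y"
      using zadeh_attained[OF assms x(1)] by blast
    with x show "x \<in> T ` level_set M A \<alpha>" by (auto simp: level_set_def)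
  qed
  show "T ` level_set M A \<alpha> \<subseteq> level_set M (zadeh M T A) \<alpha>"
  proof
    fix x assume "x \<in> T ` level_set M A \<alpha>"
    then obtain z where z: "z \<in> M" "\<alpha> \<le> A z" "x = T z" by (auto simp: level_set_def)
    then have x: "x \<in> M" using map_closed by blast
    obtain y where "zadeh M T A x = A y" "A z \<le> A y"
      using zadeh_attained[OF assms x] z by metis
    with x z show "x \<in> level_set M (zadeh M T A) \<alpha>" by (auto simp: level_set_def)
  qed
qed

text \<open>Upper semicontinuity survives because the new level sets are continuous images of
  compact sets, hence compact, hence closed in a Hausdorff space.\<close>

lemma zadeh_fuzzy_sets:
  assumes A: "A \<in> fuzzy_sets M d"
  shows "zadeh M T A \<in> fuzzy_sets M d"
  unfolding fuzzy_sets_def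
proof (intro CollectI conjI allI PiE_I)
  fix x assume "x \<in> M"
  then obtain y where "y \<in> M" "zadeh M T A x = A y"
    using zadeh_attained[OF A] by blast
  then show "zadeh M T A x \<in> {0..1}"
    using A by (auto simp: fuzzy_sets_def PiE_iff)
next
  fix x assume "x \<notin> M"
  then show "zadeh M T A x = undefined" by (simp add: zadeh_def)
next
  fix r
  have "compactin mtopology (level_set M A r)"
    using closedin_level_set[OF A] closedin_compact_space compact by blast
  then have "closedin mtopology (level_set M (zadeh M T A) r)"
    unfolding level_set_zadeh[OF A]
    using compactin_imp_closedin[OF Hausdorff_space_mtopology] image_compactin continuous by blast
  moreover have "{x \<in> M. zadeh M T A x < r} = M - level_set M (zadeh M T A) r"
    by (auto simp: level_set_def)
  ultimately show "openin mtopology {x \<in> M. zadeh M T A x < r}"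
    by (simp add: closedin_def)
qed

lemma zadeh_funpow_fuzzy_sets:
  "A \<in> fuzzy_sets M d \<Longrightarrow> (zadeh M T ^^ n) A \<in> fuzzy_sets M d"
  by (induction n) (auto intro: zadeh_fuzzy_sets)

lemma level_set_zadeh_funpow:
  assumes "A \<in> fuzzy_sets M d"
  shows "level_set M ((zadeh M T ^^ n) A) \<alpha> = (T ^^ n) ` level_set M A \<alpha>"
  by (induction n)
    (simp_all add: level_set_zadeh zadeh_funpow_fuzzy_sets assms image_image)

section \<open>Levelwise distance and fuzzy points\<close>

lemma levelwise_dist_zadeh_funpow_le:
  assumes "A \<in> fuzzy_sets M d" "0 \<le> e" and "\<And>x. x \<in> M \<Longrightarrow> d ((T ^^ n) x) x \<le> e"
  shows "levelwise_dist M d ((zadeh M T ^^ n) A) A \<le> e"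
  unfolding levelwise_dist_def level_set_zadeh_funpow[OF assms(1)]
proof (rule cSUP_least)
  show "hausdorff_dist M d ((T ^^ n) ` level_set M A \<alpha>) (level_set M A \<alpha>) \<le> e" for \<alpha>
    using assms(2,3) by (intro hausdorff_dist_image_le) (auto simp: level_set_def)
qed simp

lemma hausdorff_dist_level_set_le_levelwise_dist:
  assumes "\<alpha> \<in> {0<..1}"
  shows "hausdorff_dist M d (level_set M A \<alpha>) (level_set M B \<alpha>) \<le> levelwise_dist M d A B"
  unfolding levelwise_dist_def
proof (rule cSUP_upper[OF assms bdd_aboveI])
  fix r
  assume "r \<in> (\<lambda>\<alpha>. hausdorff_dist M d (level_set M A \<alpha>) (level_set M B \<alpha>)) ` {0<..1}"
  then obtain \<beta> where "r = hausdorff_dist M d (level_set M A \<beta>) (level_set M B \<beta>)"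
    by blast
  then show "r \<le> diam M d"
    using hausdorff_dist_le_diam[of "level_set M A \<beta>" "level_set M B \<beta>"]
    by (simp add: level_set_def)
qed

text \<open>The characteristic function of a singleton scaled to height \<open>l\<close>; it is
  restricted to \<open>M\<close> because fuzzy sets are extensional functions.\<close>

definition fuzzy_point :: "real \<Rightarrow> 'a \<Rightarrow> 'a \<Rightarrow> real" where
  "fuzzy_point l x = (\<lambda>y\<in>M. if y = x then l else 0)"

lemma level_set_fuzzy_point:
  assumes "x \<in> M" "0 < l"
  shows "level_set M (fuzzy_point l x) l = {x}"
  using assms by (auto simp: level_set_def fuzzy_point_def)

lemma fuzzy_point_fuzzy_sets_eq:
  assumes x: "x \<in> M" and l: "l \<in> {0<..1}"
  shows "fuzzy_point l x \<in> fuzzy_sets_eq M d l"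
proof -
  have "openin mtopology {y \<in> M. fuzzy_point l x y < r}" for r
  proof -
    have "closedin mtopology {x}"
      using x by (simp add: closedin_Hausdorff_singleton Hausdorff_space_mtopology)
    then have "openin mtopology (M - {x})" by (simp add: closedin_def)
    moreover have "openin mtopology M" using openin_topspace[of mtopology] by simp
    \<comment> \<open>Only the values 0 and \<open>l\<close> occur, so there are just three possible
      strict sublevel sets, all open.\<close>
    moreover have "{y \<in> M. fuzzy_point l x y < r} =
        (if r \<le> 0 then {} else if r \<le> l then M - {x} else M)"
      using l x by (auto simp: fuzzy_point_def)
    ultimately show ?thesis by simp
  qed
  then show ?thesis
    using x l by (auto simp: fuzzy_sets_eq_def fuzzy_sets_def fuzzy_point_def)
qed

text \<open>At level \<open>l\<close> both level sets are singletons, so this one level already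
  recovers the distance between the points.\<close>

lemma dist_funpow_le_levelwise_dist:
  assumes x: "x \<in> M" and l: "l \<in> {0<..1}"
  shows "d ((T ^^ n) x) x \<le>
    levelwise_dist M d ((zadeh M T ^^ n) (fuzzy_point l x)) (fuzzy_point l x)"
proof -
  have "fuzzy_point l x \<in> fuzzy_sets M d"
    using fuzzy_point_fuzzy_sets_eq[OF assms] by (simp add: fuzzy_sets_eq_def)
  then show ?thesis
    using hausdorff_dist_level_set_le_levelwise_dist[OF l,
        of "(zadeh M T ^^ n) (fuzzy_point l x)" "fuzzy_point l x"] x l
    by (simp add: level_set_zadeh_funpow level_set_fuzzy_point hausdorff_dist_singletons)
qed

end

text \<open>The same sequence of times serves both systems, so it suffices to pass a uniform bound
  from one to the other at each fixed time. The bounds are non-strict because suprema preserve only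
  those.\<close>

lemma uniformly_rigid_transfer:
  assumes "uniformly_rigid Y \<rho> S"
    and "\<And>n e. 0 < e \<Longrightarrow> (\<And>y. y \<in> Y \<Longrightarrow> \<rho> ((S ^^ n) y) y \<le> e) \<Longrightarrow>
           (\<And>z. z \<in> Z \<Longrightarrow> \<sigma> ((R ^^ n) z) z \<le> e)"
  shows "uniformly_rigid Z \<sigma> R"
proof -
  obtain m where m: "\<forall>i. 0 < m i" "filterlim m at_top sequentially"
    and *: "\<And>e. 0 < e \<Longrightarrow> \<forall>\<^sub>F i in sequentially. \<forall>y\<in>Y. \<rho> ((S ^^ m i) y) y < e"
    using assms(1) unfolding uniformly_rigid_def by blast
  have "\<forall>\<^sub>F i in sequentially. \<forall>z\<in>Z. \<sigma> ((R ^^ m i) z) z < e" if "0 < e" for e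
  proof -
    \<comment> \<open>Halving \<open>e\<close> turns the non-strict bound back into a strict
      one.\<close>
    have e2: "0 < e / 2" using that by simp
    show ?thesis
      using *[OF e2]
    proof eventually_elim
      case (elim i)
      have "\<sigma> ((R ^^ m i) z) z \<le> e / 2" if "z \<in> Z" for z
        using assms(2)[OF e2 _ that] elim by (meson less_imp_le)
      then show ?case using e2 by force
    qed
  qed
  with m show ?thesis unfolding uniformly_rigid_def by blast
qed

section \<open>Equivalences for the hyperspace and for families of fuzzy sets\<close>

context dynamical_system
begin

lemma uniformly_rigid_hyperspace_iff:
  "uniformly_rigid M d T \<longleftrightarrow>
    uniformly_rigid (hyperspace M d) (hausdorff_dist M d) (hyper_map T)"
proof
  assume "uniformly_rigid M d T"
  then show "uniformly_rigid (hyperspace M d) (hausdorff_dist M d) (hyper_map T)"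
  proof (rule uniformly_rigid_transfer)
    fix n :: nat and e :: real and A
    assume "0 < e" "\<And>y. y \<in> M \<Longrightarrow> d ((T ^^ n) y) y \<le> e" "A \<in> hyperspace M d"
    then show "hausdorff_dist M d ((hyper_map T ^^ n) A) A \<le> e"
      using closedin_subset unfolding hyper_map_funpow
      by (intro hausdorff_dist_image_le) (fastforce simp: hyperspace_def)+
  qed
next
  assume "uniformly_rigid (hyperspace M d) (hausdorff_dist M d) (hyper_map T)"
  then show "uniformly_rigid M d T"
  proof (rule uniformly_rigid_transfer)
    fix n :: nat and e :: real and x
    assume *: "\<And>A. A \<in> hyperspace M d \<Longrightarrow> hausdorff_dist M d ((hyper_map T ^^ n) A) A \<le> e"
      and "x \<in> M"
    then have "{x} \<in> hyperspace M d"
      by (simp add: hyperspace_def closedin_Hausdorff_singleton Hausdorff_space_mtopology)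
    from *[OF this] show "d ((T ^^ n) x) x \<le> e"
      by (simp add: hyper_map_funpow hausdorff_dist_singletons)
  qed
qed

text \<open>One statement covers every family of fuzzy sets in the theorem: the upper inclusion
  makes the level set formula available, the lower one supplies the fuzzy points of height
  \<open>l\<close>.\<close>

lemma uniformly_rigid_fuzzy_iff:
  assumes l: "l \<in> {0<..1}" and Y: "fuzzy_sets_eq M d l \<subseteq> Y" "Y \<subseteq> fuzzy_sets M d"
  shows "uniformly_rigid M d T \<longleftrightarrow> uniformly_rigid Y (levelwise_dist M d) (zadeh M T)"
proof
  assume "uniformly_rigid M d T"
  then show "uniformly_rigid Y (levelwise_dist M d) (zadeh M T)"
    by (rule uniformly_rigid_transfer)
      (use Y(2) in \<open>auto intro!: levelwise_dist_zadeh_funpow_le\<close>)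
next
  assume "uniformly_rigid Y (levelwise_dist M d) (zadeh M T)"
  then show "uniformly_rigid M d T"
  proof (rule uniformly_rigid_transfer)
    fix n :: nat and e :: real and x
    assume *: "\<And>A. A \<in> Y \<Longrightarrow> levelwise_dist M d ((zadeh M T ^^ n) A) A \<le> e" and x: "x \<in> M"
    have "fuzzy_point l x \<in> Y"
      using fuzzy_point_fuzzy_sets_eq[OF x l] Y(1) by blast
    from *[OF this] show "d ((T ^^ n) x) x \<le> e"
      using dist_funpow_le_levelwise_dist[OF x l, of n] by linarith
  qed
qed

end

theorem theorem7:
  fixes M :: "'a set" and d :: "'a \<Rightarrow> 'a \<Rightarrow> real" and T :: "'a \<Rightarrow> 'a"
  assumes "dynamical_system M d T"
  shows "(uniformly_rigid M d T \<longleftrightarrow>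
            uniformly_rigid (hyperspace M d) (hausdorff_dist M d) (hyper_map T))
       \<and> (uniformly_rigid M d T \<longleftrightarrow>
            uniformly_rigid (fuzzy_sets_nonempty M d) (levelwise_dist M d) (zadeh M T))
       \<and> (uniformly_rigid M d T \<longleftrightarrow>
            (\<forall>l\<in>{0<..1}. uniformly_rigid (fuzzy_sets_eq M d l) (levelwise_dist M d) (zadeh M T)))
       \<and> (uniformly_rigid M d T \<longleftrightarrow>
            (\<forall>l\<in>{0<..1}. uniformly_rigid (fuzzy_sets_ge M d l) (levelwise_dist M d) (zadeh M T)))
       \<and> (uniformly_rigid M d T \<longleftrightarrow>
            (\<exists>l\<in>{0<..1}. uniformly_rigid (fuzzy_sets_eq M d l) (levelwise_dist M d) (zadeh M T)))
       \<and> (uniformly_rigid M d T \<longleftrightarrow>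
            (\<exists>l\<in>{0<..1}. uniformly_rigid (fuzzy_sets_ge M d l) (levelwise_dist M d) (zadeh M T)))"
proof -
  interpret dynamical_system M d T by (fact assms)
  let ?UR = "\<lambda>Y. uniformly_rigid Y (levelwise_dist M d) (zadeh M T)"
  have eq: "uniformly_rigid M d T \<longleftrightarrow> ?UR (fuzzy_sets_eq M d l)" if "l \<in> {0<..1}" for l
    using that by (rule uniformly_rigid_fuzzy_iff) (auto simp: fuzzy_sets_eq_def)
  have ge: "uniformly_rigid M d T \<longleftrightarrow> ?UR (fuzzy_sets_ge M d l)" if "l \<in> {0<..1}" for l
    using that by (rule uniformly_rigid_fuzzy_iff)
      (auto simp: fuzzy_sets_eq_def fuzzy_sets_ge_def)
  \<comment> \<open>This level handles the nonempty fuzzy sets, and it shows that the range of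
    \<open>l\<close> is inhabited, as needed to instantiate the universal statements and to witness
    the existential ones.\<close>
  have one: "(1::real) \<in> {0<..1}" by simp
  have ne: "uniformly_rigid M d T \<longleftrightarrow> ?UR (fuzzy_sets_nonempty M d)"
    using one by (rule uniformly_rigid_fuzzy_iff)
      (force simp: fuzzy_sets_eq_def fuzzy_sets_nonempty_def)+
  show ?thesis
    using uniformly_rigid_hyperspace_iff ne eq ge one by blast
qed

end
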